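(* For every integer $r\geq 2$, the following identities of formal power series in $q$ hold: \[ \sum_{\lambda \in \mathcal{CP}_r}c_r(\lambda )\,q^{|\lambda |} =\sum_{\lambda \in \mathcal{R'P}_r}q^{|\lambda |} =\frac{(q^r;q^r)_\infty}{(q;q)_\infty}\sum_{k\geq 1}\frac{q^{rk}}{1-q^{rk}}. \]
   Context: A partition is a finite weakly decreasing sequence $\lambda=(\lambda_1,\ldots,\lambda_\ell)$ of positive integers (the empty sequence, of size $0$, is allowed); $\mathcal{P}$ is the set of all partitions, $|\lambda|=\sum_i\lambda_i$ is the size, and $m_i(\lambda)$ is the multiplicity of $i$ as a part of $\lambda$. For an integer $r\ge 2$ define: - $\mathcal{RP}_r=\{\lambda\in\mathcal{P} : m_k(\lambda)<r \text{ for all } k\geq 1\}$ ($r$-regular partitions); - $\mathcal{CP}_r=\{\lambda\in\mathcal{P} : m_{rk}(\lambda)=0 \text{ for all } k\geq 1\}$ ($r$-class regular partitions); - $\mathcal{R'P}_r=\{\lambda\in\mathcal{P} : \text{there is exactly one } k\geq 1 \text{ with } m_k(\lambda)\geq r\}$ ($r$-inferior regular partitions). Glaisher correspondence: starting from $\lambda\in\mathcal{CP}_r$, as long as some $k$ occurs at least $r$ times as a part, perform the operation of replacing $r$ copies of the part $k$ by a single part $rk$; repeat until the partition lies in $\mathcal{RP}_r$. The resulting partition is denoted $g_r(\lambda)$ (it does not depend on the choices made), and $g_r$ is a size-preserving bijection from $\mathcal{CP}_r$ to $\mathcal{RP}_r$. The number of operations performed in going from $\lambda$ to $g_r(\lambda)$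 is denoted $c_r(\lambda)$ (each operation decreases the number of parts by exactly $r-1$, so this is well defined). Notation: $(a;b)_k=(1-a)(1-ab)\cdots(1-ab^{k-1})$ and $(a;b)_\infty=\prod_{i\ge 0}(1-ab^i)$. *)

theory Defs
  imports
    "HOL-Analysis.Analysis"
    "HOL-Computational_Algebra.Formal_Power_Series"
    "HOL-Library.Multiset"
    "HOL-Library.Confluence"
begin

text \<open>
  A weakly decreasing finite sequence of positive integers is represented by the multiset of its
  parts; the size of the partition is then \<^const>\<open>sum_mset\<close> and the multiplicity of a part
  is \<^const>\<open>count\<close>.
\<close>

definition partitions :: "nat multiset set" where
  "partitions = {p. \<forall>i \<in># p. 0 < i}"

definition regular_partitions :: "nat \<Rightarrow> nat multiset set" where
  "regular_partitions r = {p \<in> partitions. \<forall>k\<ge>1. count p k < r}"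

definition class_regular_partitions :: "nat \<Rightarrow> nat multiset set" where
  "class_regular_partitions r = {p \<in> partitions. \<forall>k\<ge>1. count p (r * k) = 0}"

definition inferior_regular_partitions :: "nat \<Rightarrow> nat multiset set" where
  "inferior_regular_partitions r = {p \<in> partitions. \<exists>!k. k \<ge> 1 \<and> count p k \<ge> r}"

definition glaisher_step :: "nat \<Rightarrow> nat multiset \<Rightarrow> nat multiset \<Rightarrow> bool" where
  "glaisher_step r p p' \<longleftrightarrow>
     (\<exists>k\<ge>1. count p k \<ge> r \<and> p' = p - replicate_mset r k + {#r * k#})"

definition glaisher :: "nat \<Rightarrow> nat multiset \<Rightarrow> nat multiset" where
  "glaisher r p = (THE p'. p' \<in> regular_partitions r \<and> (glaisher_step r)\<^sup>*\<^sup>* p p')"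

definition glaisher_steps :: "nat \<Rightarrow> nat multiset \<Rightarrow> nat" where
  "glaisher_steps r p = (THE n. (glaisher_step r ^^ n) p (glaisher r p))"

text \<open>
  The definition is meant for arguments \<open>a = b = q\<^sup>m\<close>, where the product converges in the
  \<open>q\<close>-adic topology of the metric space of formal power series.
\<close>

definition qpochhammer_inf :: "real fps \<Rightarrow> real fps \<Rightarrow> real fps" where
  "qpochhammer_inf a b = (\<Prod>i. 1 - a * b ^ i)"


text \<open>The definite descriptions above are well defined on all partitions.\<close>

lemma glaisher_step_partitions:
  assumes "r \<ge> 2" "glaisher_step r p p'" "p \<in> partitions"
  shows "p' \<in> partitions"
  using assms by (fastforce simp: glaisher_step_def partitions_def dest: in_diffD)

lemma glaisher_steps_partitions:
  assumes "r \<ge> 2" "(glaisher_step r)\<^sup>*\<^sup>* p p'" "p \<in> partitions"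
  shows "p' \<in> partitions"
  using assms(2,3) by induction (auto intro: glaisher_step_partitions[OF assms(1)])

lemma glaisher_step_size:
  assumes "r \<ge> 2" "glaisher_step r p p'"
  shows "size p = size p' + (r - 1)"
proof -
  from assms(2) obtain k where k: "count p k \<ge> r" "p' = p - replicate_mset r k + {#r * k#}"
    by (auto simp: glaisher_step_def)
  have sub: "replicate_mset r k \<subseteq># p" using k(1) by (simp add: count_le_replicate_mset_subset_eq)
  then have "r \<le> size p" using size_mset_mono by fastforce
  then show ?thesis using k(2) sub assms(1) by (simp add: size_Diff_submset)
qed

lemma glaisher_relpow_size:
  assumes "r \<ge> 2" "(glaisher_step r ^^ n) p p'"
  shows "size p = size p' + n * (r - 1)"
  using assms(2)
proof (induction n arbitrary: p')
  case (Suc n)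
  then obtain u where "(glaisher_step r ^^ n) p u" "glaisher_step r u p'" by auto
  then show ?case using Suc.IH glaisher_step_size[OF assms(1)] by fastforce
qed auto

lemma glaisher_step_confluent:
  assumes "r \<ge> 2"
  shows "confluentp (glaisher_step r)"
proof (rule strong_confluentp_imp_confluentp, rule strong_confluentpI)
  fix x y z assume "glaisher_step r x y" "glaisher_step r x z"
  then obtain k l where
    k: "k \<ge> 1" "count x k \<ge> r" "y = x - replicate_mset r k + {#r * k#}" and
    l: "l \<ge> 1" "count x l \<ge> r" "z = x - replicate_mset r l + {#r * l#}"
    unfolding glaisher_step_def by blast
  show "\<exists>u. (glaisher_step r)\<^sup>*\<^sup>* y u \<and> (glaisher_step r)\<^sup>=\<^sup>= z u"
  proof (cases "k = l")
    case True
    then show ?thesis using k l by auto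
  next
    case False
    let ?u = "x - replicate_mset r k - replicate_mset r l + {#r * k#} + {#r * l#}"
    have 1: "?u = y - replicate_mset r l + {#r * l#}"
      using k l False by (intro multiset_eqI) auto
    have 2: "?u = z - replicate_mset r k + {#r * k#}"
      using k l False by (intro multiset_eqI) auto
    have "glaisher_step r y ?u"
      unfolding glaisher_step_def using 1 k l False by (intro exI[of _ l]) auto
    moreover have "glaisher_step r z ?u"
      unfolding glaisher_step_def using 2 k l False by (intro exI[of _ k]) auto
    ultimately show ?thesis by blast
  qed
qed

lemma regular_partitions_iff_normal:
  assumes "p \<in> partitions"
  shows "p \<in> regular_partitions r \<longleftrightarrow> (\<nexists>p'. glaisher_step r p p')"
  using assms by (auto simp: regular_partitions_def glaisher_step_def not_less)

lemma glaisher_exists: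
  assumes "r \<ge> 2" "p \<in> partitions"
  shows "\<exists>p'. p' \<in> regular_partitions r \<and> (glaisher_step r)\<^sup>*\<^sup>* p p'"
  using assms(2)
proof (induction "size p" arbitrary: p rule: less_induct)
  case less
  show ?case
  proof (cases "p \<in> regular_partitions r")
    case False
    then obtain u where u: "glaisher_step r p u"
      using regular_partitions_iff_normal less.prems by blast
    then have "size u < size p" "u \<in> partitions"
      using glaisher_step_size[OF assms(1)] glaisher_step_partitions[OF assms(1)] less.prems assms(1)
      by fastforce+
    then show ?thesis using less.hyps u by (meson converse_rtranclp_into_rtranclp)
  qed auto
qed

lemma glaisher_ex1:
  assumes "r \<ge> 2" "p \<in> partitions"
  shows "\<exists>!p'. p' \<in> regular_partitions r \<and> (glaisher_step r)\<^sup>*\<^sup>* p p'"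
proof (rule ex_ex1I[OF glaisher_exists[OF assms]])
  fix y z
  assume y: "y \<in> regular_partitions r \<and> (glaisher_step r)\<^sup>*\<^sup>* p y"
    and z: "z \<in> regular_partitions r \<and> (glaisher_step r)\<^sup>*\<^sup>* p z"
  obtain u where u: "(glaisher_step r)\<^sup>*\<^sup>* y u" "(glaisher_step r)\<^sup>*\<^sup>* z u"
    using confluentpD[OF glaisher_step_confluent[OF assms(1)]] y z by blast
  have "y \<in> partitions" "z \<in> partitions" using y z by (auto simp: regular_partitions_def)
  then have "\<nexists>v. glaisher_step r y v" "\<nexists>v. glaisher_step r z v"
    using y z regular_partitions_iff_normal by blast+
  then show "y = z" using u by (metis converse_rtranclpE)
qed

lemma glaisher_steps_ex1:
  assumes "r \<ge> 2" "p \<in> partitions"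
  shows "\<exists>!n. (glaisher_step r ^^ n) p (glaisher r p)"
proof (rule ex_ex1I)
  have "(glaisher_step r)\<^sup>*\<^sup>* p (glaisher r p)"
    unfolding glaisher_def using theI'[OF glaisher_ex1[OF assms]] by blast
  then show "\<exists>n. (glaisher_step r ^^ n) p (glaisher r p)"
    by (rule rtranclp_imp_relpowp)
next
  fix m n
  assume "(glaisher_step r ^^ m) p (glaisher r p)" "(glaisher_step r ^^ n) p (glaisher r p)"
  then have "m * (r - 1) = n * (r - 1)" using glaisher_relpow_size[OF assms(1)]
    by (metis add_left_cancel)
  then show "m = n" using assms(1) by simp
qed


text \<open>The infinite products and the series on the right-hand side converge.\<close>

lemma qpochhammer_inf_has_prod:
  assumes "m > 0"
  shows "(\<lambda>i. 1 - fps_X ^ m * (fps_X ^ m) ^ i) has_prod qpochhammer_inf (fps_X ^ m) (fps_X ^ m)"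
proof -
  define f :: "nat \<Rightarrow> real fps" where "f = (\<lambda>i. 1 - fps_X ^ m * (fps_X ^ m) ^ i)"
  have f: "f i = 1 - fps_X ^ (m + m * i)" for i
    by (simp add: f_def power_add power_mult)
  have f0: "fps_nth (f i) 0 = 1" for i
    using assms by (simp add: f)
  have nz: "f i \<noteq> 0" for i
    using f0[of i] by auto
  have "n < subdegree (f k - 1)" if "k > n" for n k
  proof -
    have "f k - 1 = - (fps_X ^ (m + m * k))" by (simp add: f)
    then have "subdegree (f k - 1) = m + m * k" by simp
    moreover have "k \<le> m * k" using assms by simp
    ultimately show ?thesis using that by linarith
  qed
  then obtain P where P: "(\<lambda>n. \<Prod>k\<le>n. f k) \<longlonglongrightarrow> P"
    using tendsto_prod_fps[of f "\<lambda>n. n"] nz by blast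
  have "fps_nth (\<Prod>k\<le>n. f k) 0 = 1" for n
    by (induction n) (simp_all add: f0 fps_mult_nth)
  then have "fps_nth P 0 = 1"
    using P unfolding tendsto_fps_iff by (auto dest: spec[of _ 0])
  then have "P \<noteq> 0" by auto
  then have "f has_prod P" using P by (simp add: has_prod_def raw_has_prod_def)
  then show ?thesis
    using has_prod_unique unfolding f_def qpochhammer_inf_def by blast
qed

lemma lambert_series_summable:
  assumes "r > 0"
  shows "(\<lambda>k. fps_X ^ (r * k) / (1 - fps_X ^ (r * k)) :: real fps) summable_on {1..}"
proof -
  define F :: "nat \<Rightarrow> real fps" where "F = (\<lambda>k. fps_X ^ (r * k) / (1 - fps_X ^ (r * k)))"
  have zero: "fps_nth (F k) n = 0" if "k \<ge> 1" "n < k" for n k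
  proof -
    have "k \<le> r * k" using assms by simp
    then have "n < r * k" using that by linarith
    moreover have "fps_nth (1 - fps_X ^ (r * k) :: real fps) 0 \<noteq> 0" using assms that by simp
    ultimately show ?thesis using that
      by (simp add: F_def fps_divide_unit fps_X_power_mult_nth)
  qed
  have "finite {k \<in> {1..}. fps_nth (F k) n \<noteq> 0}" for n
    by (rule finite_subset[of _ "{..n}"]) (use zero in \<open>auto simp: not_less[symmetric]\<close>)
  then have "(F has_sum Abs_fps (\<lambda>n. \<Sum>k | k \<in> {1..} \<and> fps_nth (F k) n \<noteq> 0. fps_nth (F k) n)) {1..}"
    by (intro has_sum_fpsI) auto
  then show ?thesis unfolding F_def summable_on_def by blast
qed

end

theory Submission
  imports Defs
begin

text \<open>
  All three series equal the generating function of the triples \<open>(p, k, j)\<close> with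
  \<open>p\<close> an \<open>r\<close>-class regular (or, equally well, \<open>r\<close>-regular) partition and \<open>k, j \<ge> 1\<close>, where such a
  triple has weight \<open>|p| + r k j\<close>. The factor for the pairs \<open>(k, j)\<close> is the Lambert series,
  because \<open>q\<^sup>a / (1 - q\<^sup>a)\<close> is the sum of \<open>q\<^sup>a\<^sup>j\<close> over \<open>j \<ge> 1\<close>.

  For inferior regular partitions the correspondence is immediate: exactly one part \<open>k\<close> has
  multiplicity at least \<open>r\<close>, and removing the largest possible multiple \<open>r j\<close> of copies of
  \<open>k\<close> leaves an \<open>r\<close>-regular partition (\<open>bij_betw_regular_inferior\<close>).

  For the steps of the Glaisher correspondence, think of adding with carries in base \<open>r\<close>. A
  step at \<open>k\<close> moves mass \<open>r k\<close> from the part \<open>k\<close> to the part \<open>r k\<close>. Let \<open>S k\<close> be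
  the total mass of the parts \<open>k, k/r, k/r\<^sup>2, \<dots>\<close>, as far as these are integers. A step at
  \<open>k\<close> lowers \<open>S k\<close> by \<open>r k\<close> and changes no other value of \<open>S\<close>, while in an
  \<open>r\<close>-regular partition \<open>S k < r k\<close>. Hence the number of steps is the sum over \<open>k\<close> of
  \<open>S k div (r k)\<close>, that is, the number of pairs \<open>(k, j)\<close> with \<open>j \<ge> 1\<close> and
  \<open>r k j \<le> S k\<close> (\<open>glaisher_steps_eq_carry_count\<close>, \<open>card_carries\<close>). If \<open>p\<close> is
  \<open>r\<close>-class regular and \<open>k = m r\<^sup>e\<close> with \<open>m\<close> not divisible by \<open>r\<close>, then all of
  \<open>S k\<close> sits in the copies of \<open>m\<close>; such a pair therefore says that mass \<open>r k j\<close> can be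
  removed from \<open>p\<close> in the form of parts \<open>m\<close>, and removing it gives the triple
  (\<open>bij_betw_class_regular_carries\<close>).

  What remains is that \<open>r\<close>-regular and \<open>r\<close>-class regular partitions have the same
  generating function, and that it is the quotient of products. Both statements follow by
  factoring the generating function of all partitions, once according to whether \<open>r\<close> divides a
  part, and once by division with remainder of the multiplicities by \<open>r\<close>
  (\<open>gf_class_regular\<close>, \<open>gf_regular_eq_class_regular\<close>), together with the product formula of
  Euler (\<open>gf_partitions_into_multiples\<close>).
\<close>

section \<open>Generating functions of graded sets\<close>

text \<open>
  An infinite fibre has cardinality \<open>0\<close> and so contributes nothing; the identities that add or
  multiply cardinalities therefore assume that all fibres are finite.
\<close>
definition gf :: "'a set \<Rightarrow> ('a \<Rightarrow> nat) \<Rightarrow> real fps" where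
  "gf A w = Abs_fps (\<lambda>n. of_nat (card {x \<in> A. w x = n}))"

definition finite_fibres :: "'a set \<Rightarrow> ('a \<Rightarrow> nat) \<Rightarrow> bool" where
  "finite_fibres A w \<longleftrightarrow> (\<forall>n. finite {x \<in> A. w x = n})"

lemma fps_nth_gf: "fps_nth (gf A w) n = of_nat (card {x \<in> A. w x = n})"
  by (simp add: gf_def)

lemma finite_fibresD: "finite_fibres A w \<Longrightarrow> finite {x \<in> A. w x = n}"
  by (simp add: finite_fibres_def)

lemma finite_fibres_subset: "finite_fibres B w \<Longrightarrow> A \<subseteq> B \<Longrightarrow> finite_fibres A w"
  unfolding finite_fibres_def by (blast intro: finite_subset[rotated])

lemma bij_betw_fibre:
  assumes "bij_betw f A B" "\<And>x. x \<in> A \<Longrightarrow> v (f x) = w x"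
  shows "bij_betw f {x \<in> A. w x = n} {y \<in> B. v y = n}"
  using assms unfolding bij_betw_def inj_on_def by (auto simp: image_iff)

lemma gf_bij_betw:
  assumes "bij_betw f A B" "\<And>x. x \<in> A \<Longrightarrow> v (f x) = w x"
  shows "gf B v = gf A w"
  using bij_betw_same_card[OF bij_betw_fibre[where v = v and w = w and f = f, OF assms]]
  by (auto simp: gf_def)

lemma finite_fibres_bij_betw:
  assumes "bij_betw f A B" "\<And>x. x \<in> A \<Longrightarrow> v (f x) = w x" "finite_fibres A w"
  shows "finite_fibres B v"
  using bij_betw_finite[OF bij_betw_fibre[where v = v and w = w and f = f, OF assms(1,2)]] assms(3)
  by (auto simp: finite_fibres_def)

lemma gf_Un_disjoint:
  assumes "finite_fibres A w" "finite_fibres B w" "A \<inter> B = {}"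
  shows "gf (A \<union> B) w = gf A w + gf B w"
proof (rule fps_ext)
  fix n
  have "{x \<in> A \<union> B. w x = n} = {x \<in> A. w x = n} \<union> {x \<in> B. w x = n}" by auto
  moreover have "{x \<in> A. w x = n} \<inter> {x \<in> B. w x = n} = {}" using assms(3) by auto
  ultimately show "fps_nth (gf (A \<union> B) w) n = fps_nth (gf A w + gf B w) n"
    using assms by (simp add: fps_nth_gf card_Un_disjoint finite_fibres_def)
qed

lemma gf_shift: "gf A (\<lambda>x. a + w x) = fps_X ^ a * gf A w"
proof (rule fps_ext)
  fix n
  have "{x \<in> A. a + w x = n} = (if n < a then {} else {x \<in> A. w x = n - a})" by auto
  then show "fps_nth (gf A (\<lambda>x. a + w x)) n = fps_nth (fps_X ^ a * gf A w) n"
    by (simp add: fps_nth_gf fps_X_power_mult_nth)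
qed

lemma
  assumes "finite_fibres A v" "finite_fibres B w"
  shows finite_fibres_Times: "finite_fibres (A \<times> B) (\<lambda>(x, y). v x + w y)"
    and gf_Times: "gf (A \<times> B) (\<lambda>(x, y). v x + w y) = gf A v * gf B w"
proof -
  have fibre: "{z \<in> A \<times> B. (case z of (x, y) \<Rightarrow> v x + w y) = n}
      = (\<Union>i\<in>{0..n}. {x \<in> A. v x = i} \<times> {y \<in> B. w y = n - i})" for n
    by auto
  note fin = finite_fibresD[OF assms(1)] finite_fibresD[OF assms(2)]
  show "finite_fibres (A \<times> B) (\<lambda>(x, y). v x + w y)"
    unfolding finite_fibres_def fibre using fin by simp
  show "gf (A \<times> B) (\<lambda>(x, y). v x + w y) = gf A v * gf B w"
  proof (rule fps_ext)
    fix n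
    have "card (\<Union>i\<in>{0..n}. {x \<in> A. v x = i} \<times> {y \<in> B. w y = n - i})
        = (\<Sum>i\<in>{0..n}. card ({x \<in> A. v x = i} \<times> {y \<in> B. w y = n - i}))"
      by (rule card_UN_disjoint) (use fin in auto)
    then show "fps_nth (gf (A \<times> B) (\<lambda>(x, y). v x + w y)) n = fps_nth (gf A v * gf B w) n"
      unfolding fps_nth_gf fibre fps_mult_nth by (simp add: card_cartesian_product)
  qed
qed

text \<open>
  The bridge from counting to infinite sums of formal power series: only finitely many summands
  contribute to a given coefficient. With a one-element set \<open>T k\<close> it gives the plain sum of
  monomials, with \<open>T k\<close> the set of Glaisher steps the weighted sum over partitions, and with
  \<open>T k\<close> the positive integers the Lambert series.
\<close>
lemma has_sum_gf_Sigma: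
  assumes fin: "finite_fibres (Sigma K T) (\<lambda>(k, t). w k t)"
    and F: "\<And>k. k \<in> K \<Longrightarrow> F k = gf (T k) (w k)"
  shows "(F has_sum gf (Sigma K T) (\<lambda>(k, t). w k t)) K"
proof (rule has_sum_fpsI)
  fix n
  let ?fib = "{z \<in> Sigma K T. (case z of (k, t) \<Rightarrow> w k t) = n}"
  let ?T = "\<lambda>k. {t \<in> T k. w k t = n}"
  let ?K = "{k \<in> K. fps_nth (F k) n \<noteq> 0}"
  have fib: "finite ?fib" using fin by (rule finite_fibresD)
  have finT: "finite (?T k)" if "k \<in> K" for k
    by (rule finite_subset[OF _ finite_imageI[OF fib, of snd]]) (use that in force)
  have nth: "fps_nth (F k) n = of_nat (card (?T k))" if "k \<in> K" for k
    using F that by (simp add: fps_nth_gf)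
  have "?K \<subseteq> fst ` ?fib"
  proof
    fix k assume k: "k \<in> ?K"
    then have "?T k \<noteq> {}" using nth by fastforce
    then obtain t where "t \<in> T k" "w k t = n" by blast
    then show "k \<in> fst ` ?fib" using k by force
  qed
  then show finK: "finite ?K" using fib finite_surj by blast
  have "?fib = Sigma ?K ?T" using nth finT by fastforce
  then have "card ?fib = (\<Sum>k\<in>?K. card (?T k))"
    using card_SigmaI[OF finK, of ?T] finT by simp
  then show "fps_nth (gf (Sigma K T) (\<lambda>(k, t). w k t)) n = (\<Sum>k\<in>?K. fps_nth (F k) n)"
    using nth by (simp add: fps_nth_gf)
qed

lemma has_sum_gf:
  assumes "finite_fibres A w"
  shows "((\<lambda>x. fps_X ^ w x) has_sum gf A w) A"
proof -
  have b: "bij_betw fst (A \<times> {()}) A" by (auto simp: bij_betw_def inj_on_def)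
  have b': "bij_betw (\<lambda>x. (x, ())) A (A \<times> {()})" by (auto simp: bij_betw_def inj_on_def)
  have "((\<lambda>x. fps_X ^ w x) has_sum gf (A \<times> {()}) (\<lambda>(x, _). w x)) A"
  proof (rule has_sum_gf_Sigma)
    show "finite_fibres (A \<times> {()}) (\<lambda>(x, _). w x)"
      by (rule finite_fibres_bij_betw[OF b' _ assms]) auto
    show "fps_X ^ w x = gf {()} (\<lambda>_. w x)" for x
      by (rule fps_ext) (auto simp: fps_nth_gf fps_X_power_nth)
  qed
  then show ?thesis
    using gf_bij_betw[OF b, of w "\<lambda>(x, _). w x"] by auto
qed

text \<open>
  The shape in which a geometric series is met here: \<open>G\<close> belongs to a graded set that is the
  disjoint union of a subset with series \<open>A\<close> and a shifted copy of the whole set.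
\<close>
lemma fixed_point_mult_one_minus:
  fixes G :: "'a :: comm_ring_1"
  assumes "G = A + x * G"
  shows "G * (1 - x) = A"
proof -
  have "G * (1 - x) = G - x * G" by (simp add: algebra_simps)
  also have "\<dots> = A" by (metis assms add_diff_cancel_right')
  finally show ?thesis .
qed

lemma gf_multiples:
  assumes "a > 0"
  shows "gf {1..} (\<lambda>j. a * j) = fps_X ^ a / (1 - fps_X ^ a)"
proof -
  have fin: "finite_fibres S (\<lambda>j. a * j)" for S :: "nat set"
    unfolding finite_fibres_def
  proof
    fix n
    have "{j \<in> S. a * j = n} \<subseteq> {..n}" using assms by auto
    then show "finite {j \<in> S. a * j = n}" by (rule finite_subset) simp
  qed
  have "gf {Suc 1..} (\<lambda>j. a * j) = gf {1..} (\<lambda>j. a + a * j)"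
  proof (rule gf_bij_betw)
    show "bij_betw Suc {1..} {Suc 1..}"
      by (rule bij_betw_byWitness[where f' = "\<lambda>j. j - 1"]) auto
  qed simp
  moreover have "gf {1} (\<lambda>j. a * j) = fps_X ^ a"
    using assms
    by (intro fps_ext) (simp add: fps_nth_gf fps_X_power_nth Collect_conv_if conj_commute eq_commute[of a])
  moreover have "gf ({1} \<union> {Suc 1..}) (\<lambda>j. a * j) = gf {1} (\<lambda>j. a * j) + gf {Suc 1..} (\<lambda>j. a * j)"
    by (rule gf_Un_disjoint) (auto intro: fin)
  moreover have "{1} \<union> {Suc 1..} = {1::nat..}" by auto
  ultimately have "gf {1..} (\<lambda>j. a * j) = fps_X ^ a + fps_X ^ a * gf {1..} (\<lambda>j. a * j)"
    by (metis gf_shift)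
  then have "gf {1..} (\<lambda>j. a * j) * (1 - fps_X ^ a) = fps_X ^ a"
    by (rule fixed_point_mult_one_minus)
  moreover have "fps_nth (1 - fps_X ^ a :: real fps) 0 \<noteq> 0" using assms by simp
  ultimately show ?thesis
    by (metis nonzero_mult_div_cancel_right fps_zero_nth)
qed

section \<open>Partitions with parts in a given set\<close>

definition partitions_into :: "nat set \<Rightarrow> nat multiset set" where
  "partitions_into A = {p. set_mset p \<subseteq> A}"

lemma partitions_eq: "partitions = partitions_into {1..}"
  by (auto simp: partitions_def partitions_into_def)

text \<open>A partition of \<open>n\<close> has at most \<open>n\<close> parts, all of them at most \<open>n\<close>.\<close>
lemma finite_fibres_partitions: "finite_fibres partitions sum_mset"
  unfolding finite_fibres_def
proof
  fix n :: nat
  have "{p \<in> partitions. sum_mset p = n} \<subseteq> (\<Union>s\<le>n. multisets_of_size {..n} s)"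
  proof
    fix p :: "nat multiset" assume p: "p \<in> {p \<in> partitions. sum_mset p = n}"
    have "size p \<le> sum_mset p" if "p \<in> partitions" for p :: "nat multiset"
      using that by (induction p) (auto simp: partitions_def)
    moreover have "set_mset p \<subseteq> {..n}"
      using p by (auto dest!: multi_member_split)
    ultimately show "p \<in> (\<Union>s\<le>n. multisets_of_size {..n} s)"
      using p by (auto simp: multisets_of_size_def)
  qed
  then show "finite {p \<in> partitions. sum_mset p = n}"
    by (rule finite_subset) (auto intro: finite_multisets_of_size)
qed

lemma finite_fibres_partitions_into:
  assumes "A \<subseteq> {1..}"
  shows "finite_fibres (partitions_into A) sum_mset"
  by (rule finite_fibres_subset[OF finite_fibres_partitions])
    (use assms in \<open>auto simp: partitions_eq partitions_into_def\<close>)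

text \<open>
  Either \<open>a\<close> does not occur, or removing one copy of \<open>a\<close> leaves an arbitrary partition of the
  same kind.
\<close>
lemma gf_partitions_into_insert:
  assumes "A \<subseteq> {1..}" "a \<ge> 1" "a \<notin> A"
  shows "gf (partitions_into (insert a A)) sum_mset * (1 - fps_X ^ a) = gf (partitions_into A) sum_mset"
proof -
  let ?P = "partitions_into (insert a A)"
  let ?Q = "add_mset a ` ?P"
  have fin: "finite_fibres ?P sum_mset" using assms by (intro finite_fibres_partitions_into) auto
  have "p \<in> partitions_into A \<union> ?Q" if "p \<in> ?P" for p
  proof (cases "a \<in># p")
    case True
    then obtain q where "p = add_mset a q" by (auto dest: multi_member_split)
    then show ?thesis using that by (auto simp: partitions_into_def)
  qed (use that in \<open>auto simp: partitions_into_def\<close>)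
  then have P: "?P = partitions_into A \<union> ?Q"
    by (auto simp: partitions_into_def)
  have "gf (partitions_into A \<union> ?Q) sum_mset = gf (partitions_into A) sum_mset + gf ?Q sum_mset"
  proof (rule gf_Un_disjoint)
    show "finite_fibres (partitions_into A) sum_mset" "finite_fibres ?Q sum_mset"
      by (rule finite_fibres_subset[OF fin], use P in blast)+
    show "partitions_into A \<inter> ?Q = {}" using assms by (auto simp: partitions_into_def)
  qed
  then have "gf ?P sum_mset = gf (partitions_into A) sum_mset + gf ?Q sum_mset"
    using P by simp
  moreover have "gf ?Q sum_mset = gf ?P (\<lambda>p. a + sum_mset p)"
    by (rule gf_bij_betw[of "add_mset a"]) (auto simp: bij_betw_def inj_on_def)
  ultimately have "gf ?P sum_mset = gf (partitions_into A) sum_mset + fps_X ^ a * gf ?P sum_mset"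
    by (metis gf_shift)
  then show ?thesis by (rule fixed_point_mult_one_minus)
qed

lemma gf_partitions_into_finite:
  assumes "finite A" "A \<subseteq> {1..}"
  shows "gf (partitions_into A) sum_mset * (\<Prod>a\<in>A. 1 - fps_X ^ a) = 1"
  using assms
proof (induction A rule: finite_induct)
  case empty
  have "partitions_into {} = {{#}}" by (auto simp: partitions_into_def)
  then have "gf (partitions_into {}) sum_mset = 1"
    by (intro fps_ext) (simp add: fps_nth_gf Collect_conv_if conj_commute)
  then show ?case by simp
next
  case (insert a A)
  have "gf (partitions_into (insert a A)) sum_mset * (\<Prod>a\<in>insert a A. 1 - fps_X ^ a)
     = gf (partitions_into (insert a A)) sum_mset * (1 - fps_X ^ a) * (\<Prod>a\<in>A. 1 - fps_X ^ a)"
    using insert by (simp add: mult.assoc)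
  also have "\<dots> = gf (partitions_into A) sum_mset * (\<Prod>a\<in>A. 1 - fps_X ^ a)"
    using insert by (subst gf_partitions_into_insert) auto
  also have "\<dots> = 1" using insert by simp
  finally show ?case .
qed

lemma fps_mult_nth_cong:
  fixes f :: "'a :: semiring_0 fps"
  assumes "\<And>i. i \<le> n \<Longrightarrow> fps_nth f i = fps_nth f' i" "\<And>i. i \<le> n \<Longrightarrow> fps_nth g i = fps_nth g' i"
  shows "fps_nth (f * g) n = fps_nth (f' * g') n"
  using assms by (simp add: fps_mult_nth)

text \<open>
  Euler's product formula for parts that are multiples of \<open>m\<close>. The coefficient of \<open>q\<^sup>n\<close> only sees
  parts up to \<open>n\<close> and a finite partial product, so it can be read off from the finite case.
\<close>
lemma gf_partitions_into_multiples:
  assumes "m > 0"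
  shows "gf (partitions_into {k. k \<ge> 1 \<and> m dvd k}) sum_mset
    * qpochhammer_inf (fps_X ^ m) (fps_X ^ m) = 1"
proof (rule fps_ext)
  fix n
  let ?A = "{k. k \<ge> 1 \<and> m dvd k}" and ?f = "\<lambda>i. 1 - fps_X ^ m * (fps_X ^ m) ^ i :: real fps"
  let ?E = "qpochhammer_inf (fps_X ^ m) (fps_X ^ m)"
  \<comment> \<open>The product is indexed from 0, so its first \<open>N + 1\<close> factors belong to \<open>m, 2 m, \<dots>, (N + 1) m\<close>.\<close>
  define B where "B N = (\<lambda>i. m + m * i) ` {..N}" for N
  have prod: "(\<Prod>i\<le>N. ?f i) = (\<Prod>a\<in>B N. 1 - fps_X ^ a)" for N
    unfolding B_def using assms
    by (subst prod.reindex) (auto simp: inj_on_def power_add power_mult)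
  have "(\<lambda>N. \<Prod>i\<le>N. ?f i) \<longlonglongrightarrow> ?E"
    using has_prod_imp_tendsto[OF qpochhammer_inf_has_prod[OF assms]] .
  then have "\<forall>\<^sub>F N in sequentially. \<forall>i\<in>{..n}. fps_nth (\<Prod>i\<le>N. ?f i) i = fps_nth ?E i"
    by (auto simp: tendsto_fps_iff eventually_ball_finite_distrib)
  then have "\<forall>\<^sub>F N in sequentially. N \<ge> n \<and> (\<forall>i\<in>{..n}. fps_nth (\<Prod>i\<le>N. ?f i) i = fps_nth ?E i)"
    using eventually_ge_at_top eventually_conj by blast
  from eventually_happens'[OF sequentially_bot this]
  obtain N where N: "N \<ge> n" "\<And>i. i \<le> n \<Longrightarrow> fps_nth (\<Prod>i\<le>N. ?f i) i = fps_nth ?E i"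
    by auto
  have BA: "B N \<subseteq> ?A" using assms by (auto simp: B_def)
  have small: "k \<in> B N" if k: "k \<in> ?A" "k \<le> n" for k
  proof -
    obtain j where j: "k = m * j" "j \<ge> 1" using k by (auto elim!: dvdE intro: Suc_leI gr0I)
    moreover have "j \<le> m * j" using assms by simp
    ultimately have "j - 1 \<le> N" "k = m + m * (j - 1)"
      using k N(1) by (linarith, auto simp: algebra_simps)
    then show ?thesis unfolding B_def by blast
  qed
  have "p \<in> partitions_into (B N)" if "p \<in> partitions_into ?A" "sum_mset p \<le> n" for p
  proof -
    have "k \<le> n" if "k \<in># p" for k using that \<open>sum_mset p \<le> n\<close> by (auto dest!: multi_member_split)
    then show ?thesis using that small by (auto simp: partitions_into_def subset_iff)
  qed
  then have "{p \<in> partitions_into ?A. sum_mset p = i} = {p \<in> partitions_into (B N). sum_mset p = i}"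
    if "i \<le> n" for i
    using BA that by (auto simp: partitions_into_def)
  then have "fps_nth (gf (partitions_into ?A) sum_mset * ?E) n
      = fps_nth (gf (partitions_into (B N)) sum_mset * (\<Prod>i\<le>N. ?f i)) n"
    by (intro fps_mult_nth_cong) (auto simp: fps_nth_gf N(2))
  also have "\<dots> = fps_nth 1 n"
    unfolding prod using assms by (subst gf_partitions_into_finite) (auto simp: B_def)
  finally show "fps_nth (gf (partitions_into ?A) sum_mset * ?E) n = fps_nth 1 n" .
qed

lemma gf_partitions_into_Un:
  assumes "A \<subseteq> {1..}" "B \<subseteq> {1..}" "A \<inter> B = {}"
  shows "gf (partitions_into (A \<union> B)) sum_mset
    = gf (partitions_into A) sum_mset * gf (partitions_into B) sum_mset"
proof -
  have "bij_betw (\<lambda>(p, q). p + q) (partitions_into A \<times> partitions_into B) (partitions_into (A \<union> B))"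
  proof (rule bij_betw_byWitness[where f' = "\<lambda>p. (filter_mset (\<lambda>k. k \<in> A) p, filter_mset (\<lambda>k. k \<in> B) p)"])
    have none: "filter_mset (\<lambda>k. k \<in> C) q = {#}" if "set_mset q \<subseteq> D" "C \<inter> D = {}"
      for q :: "nat multiset" and C D
      using filter_mset_cong[of q q "\<lambda>k. k \<in> C" "\<lambda>_. False"] that by auto
    have all: "filter_mset (\<lambda>k. k \<in> C) q = q" if "set_mset q \<subseteq> C" for q :: "nat multiset" and C
      using filter_mset_cong[of q q "\<lambda>k. k \<in> C" "\<lambda>_. True"] that by auto
    have "B \<inter> A = {}" using assms(3) by auto
    then show "\<forall>z\<in>partitions_into A \<times> partitions_into B.
        (\<lambda>p. (filter_mset (\<lambda>k. k \<in> A) p, filter_mset (\<lambda>k. k \<in> B) p)) (case z of (p, q) \<Rightarrow> p + q) = z"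
      using none[OF _ assms(3)] none[of _ A B] by (auto simp: partitions_into_def all)
    show "\<forall>p\<in>partitions_into (A \<union> B).
        (case (filter_mset (\<lambda>k. k \<in> A) p, filter_mset (\<lambda>k. k \<in> B) p) of (p, q) \<Rightarrow> p + q) = p"
      using assms(3) by (auto simp: partitions_into_def intro!: multiset_eqI simp: not_in_iff[symmetric])
  qed (auto simp: partitions_into_def)
  from gf_bij_betw[OF this, of sum_mset "\<lambda>(p, q). sum_mset p + sum_mset q"] show ?thesis
    using assms by (simp add: gf_Times finite_fibres_partitions_into split: prod.splits)
qed

section \<open>Regular and class regular partitions\<close>

lemma class_regular_partitions_eq:
  "class_regular_partitions r = partitions_into {k. k \<ge> 1 \<and> \<not> r dvd k}"
proof -
  have "(\<forall>k\<ge>1. count p (r * k) = 0) \<longleftrightarrow> (\<forall>k\<in>#p. \<not> r dvd k)" if "p \<in> partitions" for p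
  proof
    assume *: "\<forall>k\<ge>1. count p (r * k) = 0"
    show "\<forall>k\<in>#p. \<not> r dvd k"
    proof
      fix k assume k: "k \<in># p"
      have "k > 0" using k that by (auto simp: partitions_def)
      then show "\<not> r dvd k" using * k
        by (metis dvdE count_eq_zero_iff mult_0_right not_less_zero less_one not_less gr0I)
    qed
  next
    assume "\<forall>k\<in>#p. \<not> r dvd k"
    then show "\<forall>k\<ge>1. count p (r * k) = 0" by (auto simp: count_eq_zero_iff)
  qed
  then show ?thesis
    by (auto simp: class_regular_partitions_def partitions_eq partitions_into_def)
qed

lemma gf_partitions_eq_class_regular_times:
  "gf partitions sum_mset = gf (class_regular_partitions r) sum_mset
     * gf (partitions_into {k. k \<ge> 1 \<and> r dvd k}) sum_mset"
proof -
  have "{k. k \<ge> 1 \<and> \<not> r dvd k} \<union> {k. k \<ge> 1 \<and> r dvd k} = {1..}" by auto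
  then show ?thesis
    using gf_partitions_into_Un[of "{k. k \<ge> 1 \<and> \<not> r dvd k}" "{k. k \<ge> 1 \<and> r dvd k}"]
    by (force simp: class_regular_partitions_eq partitions_eq)
qed

lemma multiset_with_smaller_counts:
  assumes "\<And>x. f x \<le> count M x"
  obtains N where "count N = f"
proof
  have "{x. 0 < f x} \<subseteq> set_mset M" using assms
    by (metis (mono_tags) count_greater_zero_iff mem_Collect_eq order_less_le_trans subsetI)
  then show "count (Abs_multiset f) = f"
    by (intro count_Abs_multiset) (auto intro: finite_subset)
qed

lemma sum_mset_repeat_mset [simp]: "sum_mset (repeat_mset n M) = n * sum_mset M" for M :: "nat multiset"
  by (induction M) (auto simp: algebra_simps)

lemma in_repeat_mset_iff [simp]: "x \<in># repeat_mset n M \<longleftrightarrow> n > 0 \<and> x \<in># M"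
  by (simp flip: count_greater_zero_iff)

text \<open>Division with remainder of every multiplicity by \<open>r\<close>.\<close>
lemma bij_betw_regular_times_partitions:
  assumes "r \<ge> 1"
  shows "bij_betw (\<lambda>(p, q). p + repeat_mset r q) (regular_partitions r \<times> partitions) partitions"
proof (rule bij_betwI')
  have cnt: "count p k < r" if "p \<in> regular_partitions r" for p k
  proof (cases "k = 0")
    case True
    have "0 \<notin># p" using that by (auto simp: regular_partitions_def partitions_def)
    then show ?thesis using True assms by (auto simp: not_in_iff)
  next
    case False
    then show ?thesis using that by (auto simp: regular_partitions_def)
  qed
  fix z z' assume "z \<in> regular_partitions r \<times> partitions" "z' \<in> regular_partitions r \<times> partitions"
  then obtain p q p' q' where z: "z = (p, q)" "z' = (p', q')"
    and p: "p \<in> regular_partitions r" "p' \<in> regular_partitions r" by auto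
  have "p = p' \<and> q = q'" if "p + repeat_mset r q = p' + repeat_mset r q'"
  proof -
    have eq: "count p k + r * count q k = count p' k + r * count q' k" for k
      using arg_cong[OF that, of "\<lambda>M. count M k"] by simp
    have p1: "count p k = count p' k" for k
      using arg_cong[OF eq, of "\<lambda>n. n mod r"] cnt[OF p(1)] cnt[OF p(2)] by simp
    have "count q k = count q' k" for k
      using eq[of k] p1[of k] assms by simp
    then show ?thesis using p1 by (auto intro: multiset_eqI)
  qed
  then show "((case z of (p, q) \<Rightarrow> p + repeat_mset r q)
      = (case z' of (p, q) \<Rightarrow> p + repeat_mset r q)) = (z = z')"
    by (auto simp: z)
next
  fix z assume "z \<in> regular_partitions r \<times> partitions"
  then show "(case z of (p, q) \<Rightarrow> p + repeat_mset r q) \<in> partitions"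
    by (auto simp: regular_partitions_def partitions_def)
next
  fix p assume p: "p \<in> partitions"
  obtain u where u: "count u = (\<lambda>k. count p k mod r)"
    by (rule multiset_with_smaller_counts[of "\<lambda>k. count p k mod r" p]) auto
  obtain v where v: "count v = (\<lambda>k. count p k div r)"
    by (rule multiset_with_smaller_counts[of "\<lambda>k. count p k div r" p]) auto
  have 0: "count p 0 = 0" using p by (auto simp: partitions_def not_in_iff)
  have "0 \<notin># u" "0 \<notin># v" by (simp_all add: not_in_iff u v 0)
  then have "u \<in> regular_partitions r" "v \<in> partitions"
    using assms by (auto simp: regular_partitions_def partitions_def u intro!: gr0I)
  moreover have "p = u + repeat_mset r v" by (intro multiset_eqI) (simp add: u v)
  ultimately show "\<exists>z\<in>regular_partitions r \<times> partitions. p = (case z of (p, q) \<Rightarrow> p + repeat_mset r q)"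
    by force
qed

lemma regular_partitions_subset: "regular_partitions r \<subseteq> partitions"
  by (auto simp: regular_partitions_def)

lemma class_regular_partitions_subset: "class_regular_partitions r \<subseteq> partitions"
  by (auto simp: class_regular_partitions_def)

lemma bij_betw_scale_parts:
  assumes "r \<ge> 1"
  shows "bij_betw (image_mset (\<lambda>k. r * k)) partitions (partitions_into {k. k \<ge> 1 \<and> r dvd k})"
proof (rule bij_betw_byWitness[where f' = "image_mset (\<lambda>k. k div r)"])
  show "\<forall>p\<in>partitions. image_mset (\<lambda>k. k div r) (image_mset (\<lambda>k. r * k) p) = p"
    using assms by (simp add: multiset.map_comp comp_def)
  show "\<forall>p\<in>partitions_into {k. k \<ge> 1 \<and> r dvd k}.
      image_mset (\<lambda>k. r * k) (image_mset (\<lambda>k. k div r) p) = p"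
    by (auto simp: multiset.map_comp comp_def partitions_into_def intro!: multiset.map_ident_strong)
  show "image_mset (\<lambda>k. r * k) ` partitions \<subseteq> partitions_into {k. k \<ge> 1 \<and> r dvd k}"
    using assms by (auto simp: partitions_into_def partitions_def Suc_le_eq)
  have "0 < k div r" if "k \<ge> 1" "r dvd k" for k
    using that assms by (simp add: div_greater_zero_iff dvd_imp_le)
  then show "image_mset (\<lambda>k. k div r) ` partitions_into {k. k \<ge> 1 \<and> r dvd k} \<subseteq> partitions"
    by (auto simp: partitions_into_def partitions_def subset_iff)
qed

text \<open>
  Splitting off the parts divisible by \<open>r\<close> writes the series of all partitions as a product. By
  Euler's formula the whole product and the factor for the multiples of \<open>r\<close> are inverses of
  infinite products.
\<close>
lemma gf_class_regular:
  assumes "r \<ge> 2"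
  shows "gf (class_regular_partitions r) sum_mset
      = qpochhammer_inf (fps_X ^ r) (fps_X ^ r) / qpochhammer_inf fps_X fps_X"
proof -
  let ?C = "gf (class_regular_partitions r) sum_mset" and ?P = "gf partitions sum_mset"
  let ?M = "gf (partitions_into {k. k \<ge> 1 \<and> r dvd k}) sum_mset"
  let ?E = "\<lambda>m. qpochhammer_inf (fps_X ^ m) (fps_X ^ m)"
  have P: "?P = ?C * ?M" by (rule gf_partitions_eq_class_regular_times)
  have M: "?M * ?E r = 1" using assms by (intro gf_partitions_into_multiples) auto
  have "{k::nat. k \<ge> 1 \<and> 1 dvd k} = {1..}" by auto
  then have E: "?P * ?E 1 = 1"
    using gf_partitions_into_multiples[of 1] by (simp add: partitions_eq)
  have "?C * ?E 1 = ?C * ?E 1 * (?M * ?E r)" using M by simp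
  also have "\<dots> = (?P * ?E 1) * ?E r" unfolding P by (simp add: mult_ac)
  also have "\<dots> = ?E r" using E by simp
  finally have "?C * ?E 1 = ?E r" .
  moreover have "?E 1 \<noteq> 0" using E by auto
  ultimately show ?thesis by (metis nonzero_mult_div_cancel_right power_one_right)
qed

text \<open>
  Partitions \<open>q\<close> of weight \<open>r |q|\<close> may be viewed as partitions into multiples of \<open>r\<close>, by scaling
  the parts, or as multiplicities that are multiples of \<open>r\<close>. So the same factor appears
  next to both series in the series of all partitions, and it can be cancelled.
\<close>
lemma gf_regular_eq_class_regular:
  assumes "r \<ge> 2"
  shows "gf (regular_partitions r) sum_mset = gf (class_regular_partitions r) sum_mset"
proof -
  let ?R = "gf (regular_partitions r) sum_mset" and ?C = "gf (class_regular_partitions r) sum_mset"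
  let ?M = "gf (partitions_into {k. k \<ge> 1 \<and> r dvd k}) sum_mset"
  have b: "bij_betw (image_mset (\<lambda>k. r * k)) partitions (partitions_into {k. k \<ge> 1 \<and> r dvd k})"
    using assms by (intro bij_betw_scale_parts) auto
  have w: "sum_mset (image_mset (\<lambda>k. r * k) p) = r * sum_mset p" for p :: "nat multiset"
    by (induction p) (auto simp: algebra_simps)
  have M: "?M = gf partitions (\<lambda>p. r * sum_mset p)"
    by (rule gf_bij_betw[OF b]) (simp add: w)
  have fin: "finite_fibres partitions (\<lambda>p. r * sum_mset p)"
    unfolding finite_fibres_def
  proof
    fix n
    have "{p \<in> partitions. r * sum_mset p = n} \<subseteq> {p \<in> partitions. sum_mset p = n div r}"
      using assms by auto
    then show "finite {p \<in> partitions. r * sum_mset p = n}"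
      using finite_fibresD[OF finite_fibres_partitions] finite_subset by blast
  qed
  have "gf partitions sum_mset
      = gf (regular_partitions r \<times> partitions) (\<lambda>(p, q). sum_mset p + r * sum_mset q)"
    using assms by (intro gf_bij_betw[OF bij_betw_regular_times_partitions]) auto
  also have "\<dots> = ?R * ?M"
    unfolding M
    by (rule gf_Times[OF finite_fibres_subset[OF finite_fibres_partitions regular_partitions_subset] fin])
  finally have "gf partitions sum_mset = ?R * ?M" .
  moreover have "gf partitions sum_mset = ?C * ?M"
    by (rule gf_partitions_eq_class_regular_times)
  moreover have "?M \<noteq> 0"
    using gf_partitions_into_multiples[of r] assms by auto
  ultimately show ?thesis by simp
qed

section \<open>Counting Glaisher steps\<close>

text \<open>This is the quantity \<open>S k\<close> of the introduction.\<close>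
definition chain_mass :: "nat \<Rightarrow> nat multiset \<Rightarrow> nat \<Rightarrow> nat" where
  "chain_mass r p k = sum_mset {#d \<in># p. \<exists>l. d * r ^ l = k#}"

lemma chain_mass_union [simp]: "chain_mass r (p + q) k = chain_mass r p k + chain_mass r q k"
  by (simp add: chain_mass_def)

lemma chain_mass_replicate_mset [simp]:
  "chain_mass r (replicate_mset n d) k = (if \<exists>l. d * r ^ l = k then n * d else 0)"
  by (induction n) (auto simp: chain_mass_def)

lemma chain_mass_le: "chain_mass r p k \<le> sum_mset p"
  unfolding chain_mass_def by (induction p) auto

text \<open>
  A step moves mass \<open>r k0\<close> from \<open>k0\<close> to \<open>r k0\<close>. A chain \<open>k, k/r, k/r\<^sup>2, \<dots>\<close> that contains
  \<open>r k0\<close> also contains \<open>k0\<close>, so it loses nothing; the only chain with \<open>k0\<close> but without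
  \<open>r k0\<close> is the one that starts at \<open>k = k0\<close>.
\<close>
lemma chain_mass_glaisher_step:
  assumes "r \<ge> 2" "k0 \<ge> 1" "count p k0 \<ge> r"
  shows "chain_mass r p k
    = chain_mass r (p - replicate_mset r k0 + {#r * k0#}) k + (if k = k0 then r * k0 else 0)"
proof -
  define q where "q = p - replicate_mset r k0"
  have p: "p = q + replicate_mset r k0"
    unfolding q_def using assms(3) by (simp add: count_le_replicate_mset_subset_eq)
  have above: "(\<exists>l. k0 * r ^ l = k) \<longleftrightarrow> k = k0 \<or> (\<exists>l. r * k0 * r ^ l = k)"
  proof
    assume "\<exists>l. k0 * r ^ l = k"
    then obtain l where "k0 * r ^ l = k" by blast
    then show "k = k0 \<or> (\<exists>l. r * k0 * r ^ l = k)"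
      by (cases l) (auto simp: mult_ac)
  next
    assume "k = k0 \<or> (\<exists>l. r * k0 * r ^ l = k)"
    then show "\<exists>l. k0 * r ^ l = k"
    proof
      assume "\<exists>l. r * k0 * r ^ l = k"
      then obtain l where "r * k0 * r ^ l = k" by blast
      then have "k0 * r ^ Suc l = k" by (simp add: mult_ac)
      then show ?thesis by blast
    qed (auto intro: exI[of _ 0])
  qed
  have strict: "r * k0 * r ^ l \<noteq> k0" for l
  proof -
    have "k0 < r * k0 * 1" using assms by simp
    also have "\<dots> \<le> r * k0 * r ^ l" by (rule mult_left_mono) (use assms in auto)
    finally show ?thesis by (rule less_imp_neq[THEN not_sym])
  qed
  have "chain_mass r {#r * k0#} k = (if \<exists>l. r * k0 * r ^ l = k then r * k0 else 0)"
    using chain_mass_replicate_mset[of r 1 "r * k0" k] by simp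
  then have "chain_mass r (q + {#r * k0#}) k + (if k = k0 then r * k0 else 0)
      = chain_mass r q k + (if \<exists>l. k0 * r ^ l = k then r * k0 else 0)"
    unfolding above using strict by (auto simp del: union_mset_add_mset_right)
  also have "\<dots> = chain_mass r p k"
    unfolding p by simp
  finally show ?thesis unfolding q_def by simp
qed

text \<open>
  In base \<open>r\<close> this says that \<open>k\<close> never receives enough carries to be able to pass one on:
  its own mass is at most \<open>(r - 1) k\<close> and, if \<open>r\<close> divides \<open>k\<close>, the mass of the chain from
  \<open>k / r\<close> on is less than \<open>k\<close> by induction.
\<close>
lemma chain_mass_regular:
  assumes "p \<in> regular_partitions r" "r \<ge> 2" "k \<ge> 1"
  shows "chain_mass r p k < r * k"
  using assms(3)
proof (induction k rule: less_induct)
  case (less k)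
  let ?F = "\<lambda>k. {#d \<in># p. \<exists>l. d * r ^ l = k#}"
  have "count p k < r" using assms(1) less.prems by (simp add: regular_partitions_def)
  then have cnt: "k * count p k \<le> k * (r - 1)" by (intro mult_left_mono) auto
  have rk: "k * (r - 1) + k = r * k"
    using assms(2) by (metis Suc_pred' add.commute less_le_trans mult.commute mult_Suc pos2)
  show ?case
  proof (cases "r dvd k")
    case True
    then obtain k' where k': "k = r * k'" by auto
    have less': "k' < k" "k' \<ge> 1" using k' less.prems assms(2) by auto
    have "(\<exists>l. d * r ^ l = k) \<longleftrightarrow> d = k \<or> (\<exists>l. d * r ^ l = k')" for d
    proof
      assume "\<exists>l. d * r ^ l = k"
      then obtain l where "d * r ^ l = k" by blast
      then show "d = k \<or> (\<exists>l. d * r ^ l = k')"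
        using assms(2) by (cases l) (auto simp: k')
    next
      assume "d = k \<or> (\<exists>l. d * r ^ l = k')"
      then show "\<exists>l. d * r ^ l = k"
      proof
        assume "\<exists>l. d * r ^ l = k'"
        then obtain l where "d * r ^ l = k'" by blast
        then have "d * r ^ Suc l = k" by (simp add: k' mult_ac)
        then show ?thesis by blast
      qed (auto intro: exI[of _ 0])
    qed
    moreover have "\<not> (\<exists>l. k * r ^ l = k')"
    proof
      assume "\<exists>l. k * r ^ l = k'"
      then obtain l where "k * r ^ l = k'" by blast
      moreover have "k * 1 \<le> k * r ^ l" by (rule mult_left_mono) (use assms in auto)
      ultimately show False using less' by simp
    qed
    ultimately have "?F k = replicate_mset (count p k) k + ?F k'"
      by (intro multiset_eqI) auto
    then have "chain_mass r p k = k * count p k + chain_mass r p k'"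
      by (simp add: chain_mass_def)
    moreover have "chain_mass r p k' < k" using less.IH[OF less'] k' by simp
    ultimately show ?thesis using cnt rk by linarith
  next
    case False
    have "(\<exists>l. d * r ^ l = k) \<longleftrightarrow> d = k" for d
    proof
      assume "\<exists>l. d * r ^ l = k"
      then obtain l where "d * r ^ l = k" by blast
      then show "d = k" using False by (cases l) auto
    qed (auto intro: exI[of _ 0])
    then have "chain_mass r p k = k * count p k"
      by (simp add: chain_mass_def filter_eq_replicate_mset)
    then show ?thesis using cnt rk less.prems by linarith
  qed
qed

text \<open>
  The summation range is large enough: the mass of a chain is at most the size of the partition,
  so the summand vanishes once \<open>r k\<close> exceeds that size.
\<close>
definition carry_count :: "nat \<Rightarrow> nat multiset \<Rightarrow> nat" where
  "carry_count r p = (\<Sum>k=1..sum_mset p. chain_mass r p k div (r * k))"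

lemma carry_count_step:
  assumes "r \<ge> 2" "glaisher_step r p p'"
  shows "carry_count r p = Suc (carry_count r p')"
proof -
  obtain k0 where k0: "k0 \<ge> 1" "count p k0 \<ge> r" and p': "p' = p - replicate_mset r k0 + {#r * k0#}"
    using assms(2) by (auto simp: glaisher_step_def)
  have p: "p = (p - replicate_mset r k0) + replicate_mset r k0"
    using k0 by (simp add: count_le_replicate_mset_subset_eq)
  have sum_p: "sum_mset p = sum_mset (p - replicate_mset r k0) + r * k0"
    by (subst p) simp
  then have size: "sum_mset p' = sum_mset p" by (simp add: p')
  have "k0 \<le> r * k0" using assms(1) by simp
  then have range: "k0 \<in> {1..sum_mset p}"
    using sum_p k0 unfolding atLeastAtMost_iff by linarith
  have "chain_mass r p k div (r * k) = chain_mass r p' k div (r * k) + (if k = k0 then 1 else 0)"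
    if "k \<in> {1..sum_mset p}" for k
    using chain_mass_glaisher_step[OF assms(1) k0, of k] that assms(1) by (auto simp: p')
  then have "carry_count r p
      = (\<Sum>k=1..sum_mset p. chain_mass r p' k div (r * k) + (if k = k0 then 1 else 0))"
    unfolding carry_count_def by (rule sum.cong[OF refl])
  then show ?thesis
    using range by (simp add: sum.distrib carry_count_def size)
qed

lemma carry_count_relpow:
  assumes "r \<ge> 2" "(glaisher_step r ^^ n) p p'"
  shows "carry_count r p = n + carry_count r p'"
  using assms(2)
proof (induction n arbitrary: p')
  case (Suc n)
  then obtain u where "(glaisher_step r ^^ n) p u" "glaisher_step r u p'" by auto
  then show ?case using Suc.IH carry_count_step[OF assms(1)] by fastforce
qed auto

lemma glaisher_steps_eq_carry_count:
  assumes "r \<ge> 2" "p \<in> partitions"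
  shows "glaisher_steps r p = carry_count r p"
proof -
  have steps: "(glaisher_step r ^^ glaisher_steps r p) p (glaisher r p)"
    unfolding glaisher_steps_def using theI'[OF glaisher_steps_ex1[OF assms]] .
  have "glaisher r p \<in> regular_partitions r"
    unfolding glaisher_def using theI'[OF glaisher_ex1[OF assms]] by blast
  then have "carry_count r (glaisher r p) = 0"
    unfolding carry_count_def using chain_mass_regular assms(1) by auto
  then show ?thesis using carry_count_relpow[OF assms(1) steps] by simp
qed

text \<open>
  The steps as a set: the pair \<open>(k, j)\<close> stands for the \<open>j\<close>-th step at \<open>k\<close>.
\<close>
definition carries :: "nat \<Rightarrow> nat multiset \<Rightarrow> (nat \<times> nat) set" where
  "carries r p = {(k, j). k \<ge> 1 \<and> j \<ge> 1 \<and> r * k * j \<le> chain_mass r p k}"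

lemma card_carries:
  assumes "r \<ge> 2"
  shows "card (carries r p) = carry_count r p"
proof -
  have bound: "k \<le> sum_mset p" if "r * k * j \<le> chain_mass r p k" "j \<ge> 1" for k j
  proof -
    have "1 * k * 1 \<le> r * k * j" using assms that by (intro mult_mono) auto
    then show ?thesis using that chain_mass_le[of r p k] by linarith
  qed
  have "j \<le> chain_mass r p k div (r * k) \<longleftrightarrow> r * k * j \<le> chain_mass r p k" if "k \<ge> 1" for k j
    using that assms by (simp add: less_eq_div_iff_mult_less_eq mult_ac)
  then have eq: "carries r p = Sigma {1..sum_mset p} (\<lambda>k. {1..chain_mass r p k div (r * k)})"
    unfolding carries_def using bound by auto
  show ?thesis unfolding eq carry_count_def by simp
qed

section \<open>The two correspondences with triples\<close>

lemma nondivisible_part_exists: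
  fixes r k :: nat
  assumes "r \<ge> 2" "k \<ge> 1"
  shows "\<exists>m e. m \<ge> 1 \<and> \<not> r dvd m \<and> m * r ^ e = k"
  using assms(2)
proof (induction k rule: less_induct)
  case (less k)
  show ?case
  proof (cases "r dvd k")
    case True
    then obtain k' where k': "k = r * k'" by auto
    have "k' < k" "k' \<ge> 1" using k' less.prems assms(1) by auto
    from less.IH[OF this] obtain m e where "m \<ge> 1" "\<not> r dvd m" "m * r ^ e = k'" by blast
    moreover from this have "m * r ^ Suc e = k" by (simp add: k' mult_ac)
    ultimately show ?thesis by blast
  next
    case False
    then show ?thesis using less.prems by (intro exI[of _ k] exI[of _ 0]) auto
  qed
qed

lemma nondivisible_part_unique:
  fixes r m m' :: nat
  assumes "r \<ge> 2" "\<not> r dvd m" "\<not> r dvd m'" "m * r ^ e = m' * r ^ e'"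
  shows "m = m'"
  using assms(4)
proof (induction e arbitrary: e')
  case 0
  then show ?case using assms(2) by (cases e') auto
next
  case (Suc e)
  then show ?case using assms(1,3) by (cases e') (auto simp: mult_ac)
qed

lemma chain_mass_class_regular:
  assumes "p \<in> class_regular_partitions r" "r \<ge> 2" "\<not> r dvd m" "m * r ^ e = k"
  shows "chain_mass r p k = m * count p m"
proof -
  have "(\<exists>l. d * r ^ l = k) \<longleftrightarrow> d = m" if "d \<in># p" for d
  proof -
    have "\<not> r dvd d" using that assms(1) by (auto simp: class_regular_partitions_eq partitions_into_def)
    then show ?thesis using nondivisible_part_unique[OF assms(2)] assms(3,4) by metis
  qed
  then have "{#d \<in># p. \<exists>l. d * r ^ l = k#} = {#d \<in># p. d = m#}"
    by (intro filter_mset_cong) auto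
  then show ?thesis
    by (simp add: chain_mass_def filter_eq_replicate_mset)
qed

text \<open>
  Write \<open>k = m r\<^sup>e\<close> with \<open>m\<close> not divisible by \<open>r\<close>. For \<open>j \<ge> 1\<close> and a class regular partition
  \<open>p\<close>, the pair \<open>(k, j)\<close> is a step of \<open>p\<close> exactly if
  \<open>r k j \<le> m \<cdot> count p m\<close>. As \<open>r k j\<close> is itself the mass of \<open>j r\<^bsup>e + 1\<^esup>\<close> parts \<open>m\<close>, this means that so
  many copies of \<open>m\<close> can be removed from \<open>p\<close>; the bijection puts them back.
\<close>
lemma bij_betw_class_regular_carries:
  assumes "r \<ge> 2"
  obtains f where
    "bij_betw f (class_regular_partitions r \<times> ({1..} \<times> {1..})) (Sigma (class_regular_partitions r) (carries r))"
    "\<And>p k j. k \<ge> 1 \<Longrightarrow> sum_mset (fst (f (p, k, j))) = sum_mset p + r * k * j"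
proof -
  obtain m e where m: "\<And>k. k \<ge> 1 \<Longrightarrow> m k \<ge> 1 \<and> \<not> r dvd m k \<and> m k * r ^ e k = k"
    using nondivisible_part_exists[OF assms] by metis
  define s where "s k j = replicate_mset (j * r ^ Suc (e k)) (m k)" for k j
  have rkj: "r * k * j = m k * (j * r ^ Suc (e k))" if "k \<ge> 1" for k j
  proof -
    have "r * (m k * r ^ e k) * j = m k * (j * r ^ Suc (e k))" by (simp add: mult_ac)
    then show ?thesis using m[OF that] by simp
  qed
  have carries: "(k, j) \<in> carries r p \<longleftrightarrow> j \<ge> 1 \<and> s k j \<subseteq># p"
    if "p \<in> class_regular_partitions r" "k \<ge> 1" for p k j
  proof -
    have "chain_mass r p k = m k * count p (m k)"
      using chain_mass_class_regular[OF that(1) assms] m[OF that(2)] by blast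
    then have "r * k * j \<le> chain_mass r p k \<longleftrightarrow> m k * (j * r ^ Suc (e k)) \<le> m k * count p (m k)"
      by (simp only: rkj[OF that(2)])
    also have "\<dots> \<longleftrightarrow> j * r ^ Suc (e k) \<le> count p (m k)"
      using m[OF that(2)] by (simp only: mult_le_cancel1) simp
    finally have "r * k * j \<le> chain_mass r p k \<longleftrightarrow> j * r ^ Suc (e k) \<le> count p (m k)" .
    then show ?thesis
      using that by (simp add: carries_def s_def count_le_replicate_mset_subset_eq)
  qed
  have CP: "p + s k j \<in> class_regular_partitions r" "p - s k j \<in> class_regular_partitions r"
    if "p \<in> class_regular_partitions r" "k \<ge> 1" for p k j
    using that m by (auto simp: class_regular_partitions_eq partitions_into_def s_def dest: in_diffD)
  let ?f = "\<lambda>(p, k, j). (p + s k j, k, j)"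
  show ?thesis
  proof
    show "bij_betw ?f (class_regular_partitions r \<times> ({1..} \<times> {1..}))
      (Sigma (class_regular_partitions r) (carries r))"
    proof (rule bij_betw_byWitness[where f' = "\<lambda>(p, k, j). (p - s k j, k, j)"])
      have k: "k \<ge> 1 \<and> j \<ge> 1" if "(k, j) \<in> carries r p" for k j p
        using that by (auto simp: carries_def)
      show "\<forall>z\<in>Sigma (class_regular_partitions r) (carries r).
          ?f ((\<lambda>(p, k, j). (p - s k j, k, j)) z) = z"
      proof
        fix z assume "z \<in> Sigma (class_regular_partitions r) (carries r)"
        then obtain p k j where z: "z = (p, k, j)"
          and p: "p \<in> class_regular_partitions r" "(k, j) \<in> carries r p" by auto
        have "s k j \<subseteq># p" using k[OF p(2)] carries[OF p(1)] p(2) by blast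
        then show "?f ((\<lambda>(p, k, j). (p - s k j, k, j)) z) = z" by (simp add: z)
      qed
      show "?f ` (class_regular_partitions r \<times> ({1..} \<times> {1..}))
          \<subseteq> Sigma (class_regular_partitions r) (carries r)"
        using CP carries by auto
      show "(\<lambda>(p, k, j). (p - s k j, k, j)) ` Sigma (class_regular_partitions r) (carries r)
          \<subseteq> class_regular_partitions r \<times> ({1..} \<times> {1..})"
        using k CP by auto
    qed auto
    show "sum_mset (fst (?f (p, k, j))) = sum_mset p + r * k * j" if "k \<ge> 1" for p k j
      unfolding rkj[OF that] by (simp add: s_def mult_ac)
  qed
qed

text \<open>
  After adding \<open>r j\<close> copies of \<open>k\<close> to a regular partition, \<open>k\<close> is the only part of multiplicity at
  least \<open>r\<close>, so it can be recovered; \<open>j\<close> and the old multiplicity are then the quotient and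
  the remainder of the new one modulo \<open>r\<close>.
\<close>
lemma bij_betw_regular_inferior:
  assumes "r \<ge> 2"
  shows "bij_betw (\<lambda>(p, k, j). p + replicate_mset (r * j) k)
    (regular_partitions r \<times> ({1::nat..} \<times> {1::nat..})) (inferior_regular_partitions r)"
proof (rule bij_betwI')
  have cnt: "count p k < r" if "p \<in> regular_partitions r" "k \<ge> 1" for p k
    using that by (auto simp: regular_partitions_def)
  have large: "l = k"
    if "p \<in> regular_partitions r" "l \<ge> 1" "count (p + replicate_mset n k) l \<ge> r" for p k l n
    using cnt[OF that(1,2)] that(3) by (auto split: if_splits)
  have big: "r \<le> count (p + replicate_mset (r * j) k) k" if "j \<ge> 1" for p and k j :: nat
  proof -
    have "r \<le> r * j" using that by simp
    then have "r \<le> count p k + r * j" by linarith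
    then show ?thesis by simp
  qed
  {
    fix z z' assume "z \<in> regular_partitions r \<times> ({1::nat..} \<times> {1::nat..})" "z' \<in> regular_partitions r \<times> ({1::nat..} \<times> {1::nat..})"
    then obtain p k j p' k' j' where z: "z = (p, k, j)" "z' = (p', k', j')"
      and p: "p \<in> regular_partitions r" "p' \<in> regular_partitions r" "k \<ge> 1" "j \<ge> 1" "k' \<ge> 1" "j' \<ge> 1"
      by auto
    have "z = z'" if eq: "p + replicate_mset (r * j) k = p' + replicate_mset (r * j') k'"
    proof -
      have k: "k = k'" using large[OF p(2,3)] big[OF p(4), of p k] eq by metis
      have "count p k + r * j = count p' k + r * j'"
        using arg_cong[OF eq, of "\<lambda>M. count M k"] k by simp
      then have "(count p k + r * j) div r = (count p' k + r * j') div r" by simp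
      then have "j = j'" using cnt[OF p(1,3)] cnt[OF p(2,3)] assms by simp
      then show ?thesis using eq k z by simp
    qed
    then show "((case z of (p, k, j) \<Rightarrow> p + replicate_mset (r * j) k)
      = (case z' of (p, k, j) \<Rightarrow> p + replicate_mset (r * j) k)) = (z = z')"
      by (auto simp: z)
  }
  {
    fix z assume "z \<in> regular_partitions r \<times> ({1::nat..} \<times> {1::nat..})"
    then obtain p k j where z: "z = (p, k, j)" and p: "p \<in> regular_partitions r" "k \<ge> 1" "j \<ge> 1"
      by auto
    have "p + replicate_mset (r * j) k \<in> partitions"
      using p by (auto simp: regular_partitions_def partitions_def)
    moreover have "\<exists>!l. l \<ge> 1 \<and> count (p + replicate_mset (r * j) k) l \<ge> r"
      using p(2) big[OF p(3)] large[OF p(1)] by blast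
    ultimately show "(case z of (p, k, j) \<Rightarrow> p + replicate_mset (r * j) k) \<in> inferior_regular_partitions r"
      by (simp add: z inferior_regular_partitions_def)
  }
  {
    fix p assume "p \<in> inferior_regular_partitions r"
    then obtain k where p: "p \<in> partitions" and k: "k \<ge> 1" "count p k \<ge> r"
      and unique: "\<And>l. l \<ge> 1 \<Longrightarrow> count p l \<ge> r \<Longrightarrow> l = k"
      by (auto simp: inferior_regular_partitions_def)
    let ?j = "count p k div r" and ?q = "p - replicate_mset (r * (count p k div r)) k"
    have "count ?q l < r" if "l \<ge> 1" for l
    proof (cases "l = k")
      case True
      have "count p k - r * ?j = count p k mod r" by (simp add: minus_mult_div_eq_mod)
      then show ?thesis using True assms by simp
    next
      case False
      then show ?thesis using unique[OF that] by (auto simp: not_le[symmetric])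
    qed
    then have "?q \<in> regular_partitions r"
      using p by (auto simp: regular_partitions_def partitions_def dest: in_diffD)
    moreover have "?j \<ge> 1" using k assms by (simp add: div_greater_zero_iff Suc_le_eq)
    moreover have "replicate_mset (r * ?j) k \<subseteq># p"
      by (simp flip: count_le_replicate_mset_subset_eq)
    then have "p = ?q + replicate_mset (r * ?j) k" by simp
    ultimately show "\<exists>z\<in>regular_partitions r \<times> ({1::nat..} \<times> {1::nat..}).
        p = (case z of (p, k, j) \<Rightarrow> p + replicate_mset (r * j) k)"
      using k(1) by (intro bexI[of _ "(?q, k, ?j)"]) auto
  }
qed

theorem proposition1p2:
  fixes r :: nat
  assumes "r \<ge> 2"
  shows "(\<lambda>p. of_nat (glaisher_steps r p) * (fps_X :: real fps) ^ sum_mset p)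
             summable_on class_regular_partitions r
       \<and> (\<lambda>p. (fps_X :: real fps) ^ sum_mset p) summable_on inferior_regular_partitions r
       \<and> (\<Sum>\<^sub>\<infinity>p\<in>class_regular_partitions r.
              of_nat (glaisher_steps r p) * (fps_X :: real fps) ^ sum_mset p)
         = (\<Sum>\<^sub>\<infinity>p\<in>inferior_regular_partitions r. fps_X ^ sum_mset p)
       \<and> (\<Sum>\<^sub>\<infinity>p\<in>inferior_regular_partitions r. (fps_X :: real fps) ^ sum_mset p)
         = qpochhammer_inf (fps_X ^ r) (fps_X ^ r) / qpochhammer_inf fps_X fps_X
           * (\<Sum>\<^sub>\<infinity>k\<in>{1..}. fps_X ^ (r * k) / (1 - fps_X ^ (r * k)))"
proof -
  let ?CP = "class_regular_partitions r" and ?RP = "regular_partitions r"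
  let ?IP = "inferior_regular_partitions r"
  let ?K = "{1::nat..} \<times> {1::nat..}" and ?w = "\<lambda>(k, j). r * k * j"
  let ?L = "gf ?K ?w"
  have finK: "finite_fibres ?K ?w"
    unfolding finite_fibres_def
  proof
    fix n
    have "k \<le> n \<and> j \<le> n" if "k \<ge> 1" "j \<ge> 1" "r * k * j = n" for k j
    proof -
      have "1 * k * 1 \<le> r * k * j" "1 * 1 * j \<le> r * k * j"
        using assms that by (intro mult_mono; simp)+
      then show ?thesis using that by simp
    qed
    then have "{z \<in> ?K. ?w z = n} \<subseteq> {..n} \<times> {..n}" by auto
    then show "finite {z \<in> ?K. ?w z = n}" by (rule finite_subset) simp
  qed
  have finCP: "finite_fibres ?CP sum_mset" and finRP: "finite_fibres ?RP sum_mset"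
    and finIP: "finite_fibres ?IP sum_mset"
    by (auto intro!: finite_fibres_subset[OF finite_fibres_partitions]
      simp: class_regular_partitions_def regular_partitions_def inferior_regular_partitions_def)

  have "((\<lambda>k. fps_X ^ (r * k) / (1 - fps_X ^ (r * k))) has_sum ?L) {1..}"
    by (rule has_sum_gf_Sigma[OF finK], rule gf_multiples[symmetric]) (use assms in auto)
  then have lambert: "(\<Sum>\<^sub>\<infinity>k\<in>{1..}. fps_X ^ (r * k) / (1 - fps_X ^ (r * k))) = ?L"
    by (rule infsumI)

  have "gf ?IP sum_mset = gf (?RP \<times> ?K) (\<lambda>(p, z). sum_mset p + ?w z)"
    by (rule gf_bij_betw[OF bij_betw_regular_inferior[OF assms]]) (auto simp: mult_ac)
  then have IP: "gf ?IP sum_mset = gf ?RP sum_mset * ?L"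
    using gf_Times[OF finRP finK] by simp
  have sumIP: "((\<lambda>p. fps_X ^ sum_mset p) has_sum gf ?IP sum_mset) ?IP"
    by (rule has_sum_gf[OF finIP])

  obtain f where f: "bij_betw f (?CP \<times> ?K) (Sigma ?CP (carries r))"
    and wf: "\<And>p k j. k \<ge> 1 \<Longrightarrow> sum_mset (fst (f (p, k, j))) = sum_mset p + r * k * j"
    by (rule bij_betw_class_regular_carries[OF assms]) blast
  have wf': "(case f z of (p, _) \<Rightarrow> sum_mset p) = (case z of (p, z) \<Rightarrow> sum_mset p + ?w z)"
    if "z \<in> ?CP \<times> ?K" for z
    using that wf by (auto simp: case_prod_beta)
  have "finite_fibres (Sigma ?CP (carries r)) (\<lambda>(p, _). sum_mset p)"
    by (rule finite_fibres_bij_betw[OF f wf' finite_fibres_Times[OF finCP finK]])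
  then have "((\<lambda>p. of_nat (glaisher_steps r p) * fps_X ^ sum_mset p)
      has_sum gf (Sigma ?CP (carries r)) (\<lambda>(p, _). sum_mset p)) ?CP"
  proof (rule has_sum_gf_Sigma)
    fix p assume "p \<in> ?CP"
    then have "glaisher_steps r p = card (carries r p)"
      using glaisher_steps_eq_carry_count[OF assms] card_carries[OF assms] class_regular_partitions_subset
      by (simp add: subset_iff)
    moreover have "{z \<in> carries r p. sum_mset p = n} = (if sum_mset p = n then carries r p else {})" for n
      by auto
    ultimately show "of_nat (glaisher_steps r p) * fps_X ^ sum_mset p = gf (carries r p) (\<lambda>_. sum_mset p)"
      by (intro fps_ext) (simp add: fps_nth_gf fps_X_power_nth flip: fps_of_nat)
  qed
  moreover have "gf (Sigma ?CP (carries r)) (\<lambda>(p, _). sum_mset p)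
      = gf (?CP \<times> ?K) (\<lambda>(p, z). sum_mset p + ?w z)"
    by (rule gf_bij_betw[OF f]) (rule wf')
  then have "gf (Sigma ?CP (carries r)) (\<lambda>(p, _). sum_mset p) = gf ?CP sum_mset * ?L"
    using gf_Times[OF finCP finK] by simp
  ultimately have sumCP: "((\<lambda>p. of_nat (glaisher_steps r p) * fps_X ^ sum_mset p)
      has_sum gf ?CP sum_mset * ?L) ?CP" by simp

  show ?thesis
    using sumCP sumIP infsumI[OF sumCP] infsumI[OF sumIP] lambert IP
      gf_regular_eq_class_regular[OF assms] gf_class_regular[OF assms]
    by (auto dest: has_sum_imp_summable)
qed

end
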